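(* Let $r\in Sl(G)$. Then the function $b_r:G\times G\to S^*$ defined by the rule $$b_r(\sigma,\tau)=u(\sigma)^{r(\tau)}\pi^{r(\sigma)+r(\tau)-r(\sigma\tau)},\qquad \sigma,\tau\in G,$$ is an element of $B^2(G,S^* )$ with inertial group $M_r$.
   Context: Standing assumptions: $R$ is a complete discrete valuation ring with quotient field $K$, $L$ is a finite Galois extension of $K$ with Galois group $G$, unramified with finite residue field; $S$ is the integral closure of $R$ in $L$, $\pi S$ its unique maximal ideal (with $\pi$ a fixed generator), $S^*=S\setminus\{0\}$, and $U(S)$ the group of units of $S$. The function $u:G\to U(S)$ is defined by $\sigma(\pi)=u(\sigma)\pi$. For $\sigma\in G$ and a function $a$ with values in $L$, $a^\sigma(\tau)$ means $\sigma(a(\tau))$. $Sl(G)$ is the set of all functions $r:G\to\mathbb{N}$ (with $0\in\mathbb{N}$) satisfying $r(1)=0$ and $r(\sigma\tau)\leq r(\sigma)+r(\tau)$ for all $\sigma,\tau\in G$. For $r\in Sl(G)$, $M_r=\{\sigma\in G: r(\sigma)=0\}$, which is known to be a subgroup of $G$. $B^2(G,S^* )$ is the set of all functions $b:G\times G\to S^*$ for which there exists a function $a:G\to S^*$ with $a(1)=1$ such that $b(\sigma,\tau)=a(\sigma)a^{\sigma}(\tau)a(\sigma\tau)^{-1}$ for all $\sigma,\tau\in G$ (the inverse being taken in $L$). The inertial group of such a $b$ is $H(b)=\{\sigma\in G: b(\sigma,\sigma^{-1})\in U(S)\}$. *)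

theory Defs
  imports "HOL-Algebra.Algebra"
begin

text \<open>
  All rings are subrings of one field \<open>L\<close>; a subset \<open>A\<close> of \<open>L\<close> is regarded as a ring via
  \<open>L\<lparr>carrier := A\<rparr>\<close>.
\<close>

section \<open>Complete discrete valuation rings\<close>

text \<open>Fields are excluded, since they have no nonzero prime ideal.\<close>

definition discrete_valuation_ring :: "('a, 'm) ring_scheme \<Rightarrow> bool" where
  "discrete_valuation_ring A \<longleftrightarrow>
     principal_domain A \<and> (\<exists>!P. primeideal P A \<and> P \<noteq> {\<zero>\<^bsub>A\<^esub>})"

text \<open>Only meaningful for local rings.\<close>

definition max_ideal :: "('a, 'm) ring_scheme \<Rightarrow> 'a set" where
  "max_ideal A = (THE M. maximalideal M A)"

definition ideal_power :: "('a, 'm) ring_scheme \<Rightarrow> 'a set \<Rightarrow> nat \<Rightarrow> 'a set" where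
  "ideal_power A I n = I [^]\<^bsub>ideals_set A\<^esub> n"

definition adically_complete :: "('a, 'm) ring_scheme \<Rightarrow> 'a set \<Rightarrow> bool" where
  "adically_complete A I \<longleftrightarrow>
     (\<Inter>k. ideal_power A I k) = {\<zero>\<^bsub>A\<^esub>} \<and>
     (\<forall>x :: nat \<Rightarrow> 'a. range x \<subseteq> carrier A \<longrightarrow>
        (\<forall>k. \<exists>N. \<forall>m\<ge>N. \<forall>n\<ge>N. x m \<ominus>\<^bsub>A\<^esub> x n \<in> ideal_power A I k) \<longrightarrow>
        (\<exists>y\<in>carrier A. \<forall>k. \<exists>N. \<forall>n\<ge>N. x n \<ominus>\<^bsub>A\<^esub> y \<in> ideal_power A I k))"

section \<open>Field extensions\<close>

definition quotient_field_in :: "('a, 'm) ring_scheme \<Rightarrow> 'a set \<Rightarrow> 'a set" where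
  "quotient_field_in L R = {x \<otimes>\<^bsub>L\<^esub> inv\<^bsub>L\<^esub> y | x y. x \<in> R \<and> y \<in> R - {\<zero>\<^bsub>L\<^esub>}}"

definition integral_closure :: "('a, 'm) ring_scheme \<Rightarrow> 'a set \<Rightarrow> 'a set" where
  "integral_closure L R =
     {x \<in> carrier L. \<exists>p. polynomial\<^bsub>L\<^esub> R p \<and> p \<noteq> [] \<and> lead_coeff p = \<one>\<^bsub>L\<^esub> \<and>
        ring.eval L p x = \<zero>\<^bsub>L\<^esub>}"

text \<open>
  Automorphisms are extensional functions on \<open>carrier L\<close>, as in \<^const>\<open>AutoGroup\<close>; the product
  \<open>\<sigma>\<tau>\<close> maps \<open>x\<close> to \<open>\<sigma> (\<tau> x)\<close>.
\<close>

definition galois_group :: "('a, 'm) ring_scheme \<Rightarrow> 'a set \<Rightarrow> ('a \<Rightarrow> 'a) monoid" where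
  "galois_group L K = BijGroup (carrier L)
     \<lparr>carrier := {\<sigma> \<in> Bij (carrier L). \<sigma> \<in> ring_hom L L \<and> (\<forall>x\<in>K. \<sigma> x = x)}\<rparr>"

definition finite_galois_extension :: "('a, 'm) ring_scheme \<Rightarrow> 'a set \<Rightarrow> bool" where
  "finite_galois_extension L K \<longleftrightarrow>
     field L \<and> subfield K L \<and> ring.finite_dimension L K (carrier L) \<and>
     {x \<in> carrier L. \<forall>\<sigma>\<in>carrier (galois_group L K). \<sigma> x = x} = K"

text \<open>
  For local rings \<open>R \<subseteq> S\<close>: ramification index one. Separability of the residue field extension
  is not part of the definition because it is automatic when, as below, the residue field of
  \<open>R\<close> is finite.
\<close>

definition unramified_in :: "('a, 'm) ring_scheme \<Rightarrow> 'a set \<Rightarrow> 'a set \<Rightarrow> bool" where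
  "unramified_in L R S \<longleftrightarrow>
     Idl\<^bsub>L\<lparr>carrier := S\<rparr>\<^esub> (max_ideal (L\<lparr>carrier := R\<rparr>)) = max_ideal (L\<lparr>carrier := S\<rparr>)"

locale complete_unramified_galois_extension =
  fixes L :: "('a, 'm) ring_scheme" and K R S :: "'a set"
    and G :: "('a \<Rightarrow> 'a) monoid" and \<pi> :: 'a
  assumes subring_R: "subring R L"
    and dvr_R: "discrete_valuation_ring (L\<lparr>carrier := R\<rparr>)"
    and complete_R: "adically_complete (L\<lparr>carrier := R\<rparr>) (max_ideal (L\<lparr>carrier := R\<rparr>))"
    and finite_residue_field:
      "finite (carrier (L\<lparr>carrier := R\<rparr> Quot max_ideal (L\<lparr>carrier := R\<rparr>)))"
    and quotient_field: "K = quotient_field_in L R"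
    and galois: "finite_galois_extension L K"
    and G_eq: "G = galois_group L K"
    and S_eq: "S = integral_closure L R"
    and pi_in_S: "\<pi> \<in> S"
    and unique_maximal_ideal:
      "{M. maximalideal M (L\<lparr>carrier := S\<rparr>)} = {PIdl\<^bsub>L\<lparr>carrier := S\<rparr>\<^esub> \<pi>}"
    and unramified: "unramified_in L R S"

section \<open>Cocycles with values in the nonzero integers of L\<close>

definition nonzero_elems :: "('a, 'm) ring_scheme \<Rightarrow> 'a set \<Rightarrow> 'a set" where
  "nonzero_elems L S = S - {\<zero>\<^bsub>L\<^esub>}"

text \<open>The solution in \<open>L\<close> of \<open>\<sigma> \<pi> = u \<sigma> \<otimes> \<pi>\<close>; that it is a unit of \<open>S\<close> is not built in.\<close>

definition u_fun :: "('a, 'm) ring_scheme \<Rightarrow> 'a \<Rightarrow> ('a \<Rightarrow> 'a) \<Rightarrow> 'a" where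
  "u_fun L \<pi> \<sigma> = \<sigma> \<pi> \<otimes>\<^bsub>L\<^esub> inv\<^bsub>L\<^esub> \<pi>"

text \<open>
  Functions on \<open>G\<close> are total in HOL: only their values on \<open>carrier G\<close> are constrained in
  the definitions below.
\<close>

definition Sl :: "('g, 'n) monoid_scheme \<Rightarrow> ('g \<Rightarrow> nat) set" where
  "Sl G = {r. r \<one>\<^bsub>G\<^esub> = 0 \<and>
     (\<forall>\<sigma>\<in>carrier G. \<forall>\<tau>\<in>carrier G. r (\<sigma> \<otimes>\<^bsub>G\<^esub> \<tau>) \<le> r \<sigma> + r \<tau>)}"

definition M_set :: "('g, 'n) monoid_scheme \<Rightarrow> ('g \<Rightarrow> nat) \<Rightarrow> 'g set" where
  "M_set G r = {\<sigma> \<in> carrier G. r \<sigma> = 0}"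

definition B2 ::
  "('a, 'm) ring_scheme \<Rightarrow> 'a set \<Rightarrow> ('a \<Rightarrow> 'a) monoid \<Rightarrow> (('a \<Rightarrow> 'a) \<Rightarrow> ('a \<Rightarrow> 'a) \<Rightarrow> 'a) set" where
  "B2 L S G =
     {b \<in> carrier G \<rightarrow> carrier G \<rightarrow> nonzero_elems L S.
        \<exists>a \<in> carrier G \<rightarrow> nonzero_elems L S. a \<one>\<^bsub>G\<^esub> = \<one>\<^bsub>L\<^esub> \<and>
          (\<forall>\<sigma>\<in>carrier G. \<forall>\<tau>\<in>carrier G.
             b \<sigma> \<tau> = a \<sigma> \<otimes>\<^bsub>L\<^esub> \<sigma> (a \<tau>) \<otimes>\<^bsub>L\<^esub> inv\<^bsub>L\<^esub> (a (\<sigma> \<otimes>\<^bsub>G\<^esub> \<tau>)))}"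

definition inertial_group ::
  "('a, 'm) ring_scheme \<Rightarrow> 'a set \<Rightarrow> ('a \<Rightarrow> 'a) monoid \<Rightarrow> (('a \<Rightarrow> 'a) \<Rightarrow> ('a \<Rightarrow> 'a) \<Rightarrow> 'a)
     \<Rightarrow> ('a \<Rightarrow> 'a) set" where
  "inertial_group L S G b =
     {\<sigma> \<in> carrier G. b \<sigma> (inv\<^bsub>G\<^esub> \<sigma>) \<in> Units (L\<lparr>carrier := S\<rparr>)}"

text \<open>For \<open>r \<in> Sl G\<close> the subtraction of natural numbers does not truncate.\<close>

definition b_fun ::
  "('a, 'm) ring_scheme \<Rightarrow> ('a \<Rightarrow> 'a) monoid \<Rightarrow> 'a \<Rightarrow> (('a \<Rightarrow> 'a) \<Rightarrow> nat)
     \<Rightarrow> ('a \<Rightarrow> 'a) \<Rightarrow> ('a \<Rightarrow> 'a) \<Rightarrow> 'a" where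
  "b_fun L G \<pi> r \<sigma> \<tau> =
     u_fun L \<pi> \<sigma> [^]\<^bsub>L\<^esub> r \<tau> \<otimes>\<^bsub>L\<^esub> \<pi> [^]\<^bsub>L\<^esub> (r \<sigma> + r \<tau> - r (\<sigma> \<otimes>\<^bsub>G\<^esub> \<tau>))"

end

theory Submission
  imports Defs
begin

text \<open>
  The cochain \<open>a(\<sigma>) = \<pi>\<^sup>r\<^sup>(\<^sup>\<sigma>\<^sup>)\<close> has coboundary \<open>b\<^sub>r\<close>. Its values are integral because \<open>u(\<sigma>)\<close> is a unit
  of \<open>S\<close>: the preimage of \<open>\<pi>S\<close> under \<open>\<sigma>\<close> is again a maximal ideal, hence \<open>\<pi>S\<close> itself, so \<open>\<pi>\<close> and
  \<open>\<sigma>(\<pi>)\<close> divide each other. Consequently \<open>b\<^sub>r(\<sigma>, \<sigma>\<^sup>-\<^sup>1)\<close> is a unit iff \<open>r(\<sigma>) + r(\<sigma>\<^sup>-\<^sup>1) = 0\<close>. As \<open>G\<close> is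
  finite, \<open>\<sigma>\<^sup>-\<^sup>1\<close> is a power of \<open>\<sigma>\<close>, and subadditivity reduces the condition to \<open>r(\<sigma>) = 0\<close>.
\<close>

text \<open>Mutually inverse ring homomorphisms induce, by taking preimages, inverse
  inclusion-preserving bijections between the ideals of the two rings. Maximality is carried along.
  The inverse \<open>g\<close> is a separate argument because preimages under it must also be
  ideals.\<close>

lemma (in ring) maximalideal_vimage_iso:
  assumes "ring_hom_ring R S f" "ring_hom_ring S R g"
    and fg: "\<And>y. y \<in> carrier S \<Longrightarrow> f (g y) = y" and gf: "\<And>x. x \<in> carrier R \<Longrightarrow> g (f x) = x"
    and "maximalideal M S"
  shows "maximalideal {x \<in> carrier R. f x \<in> M} R"
proof (rule maximalidealI)
  interpret f: ring_hom_ring R S f by fact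
  interpret g: ring_hom_ring S R g by fact
  interpret M: maximalideal M S by fact
  show "ideal {x \<in> carrier R. f x \<in> M} R"
    by (rule f.ideal_vimage[OF M.is_ideal])
  show "carrier R \<noteq> {x \<in> carrier R. f x \<in> M}"
  proof
    assume "carrier R = {x \<in> carrier R. f x \<in> M}"
    then have "y \<in> M" if "y \<in> carrier S" for y
      using that g.hom_closed[OF that] fg[OF that] by (metis (lifting) mem_Collect_eq)
    then show False
      using M.I_notcarr M.a_subset by auto
  qed
  fix J
  assume J: "ideal J R" "{x \<in> carrier R. f x \<in> M} \<subseteq> J" "J \<subseteq> carrier R"
  have "M \<subseteq> {y \<in> carrier S. g y \<in> J}"
    using J(2) M.a_subset fg g.hom_closed by auto
  then have alt: "{y \<in> carrier S. g y \<in> J} = M \<or> {y \<in> carrier S. g y \<in> J} = carrier S"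
    using M.I_maximal[OF g.ideal_vimage[OF J(1)]] by auto
  \<comment> \<open>Since \<open>g\<close> undoes \<open>f\<close>, the ideal \<open>J\<close> is
    recovered as the preimage under \<open>f\<close> of its own preimage under \<open>g\<close>, so
    both alternatives in \<open>alt\<close> carry back to \<open>J\<close>.\<close>
  have mem: "x \<in> J \<longleftrightarrow> f x \<in> {y \<in> carrier S. g y \<in> J}" if "x \<in> carrier R" for x
    using that gf f.hom_closed by auto
  from alt show "J = {x \<in> carrier R. f x \<in> M} \<or> J = carrier R"
  proof
    assume eq: "{y \<in> carrier S. g y \<in> J} = M"
    have "J = {x \<in> carrier R. f x \<in> M}"
      using mem J(3) unfolding eq by blast
    then show ?thesis ..
  next
    assume eq: "{y \<in> carrier S. g y \<in> J} = carrier S"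
    have "carrier R \<subseteq> J"
      using mem f.hom_closed unfolding eq by blast
    then show ?thesis
      using J(3) by blast
  qed
qed

section \<open>The Galois group\<close>

lemma galois_group_carrier:
  "carrier (galois_group L K) =
     {\<sigma> \<in> Bij (carrier L). \<sigma> \<in> ring_hom L L \<and> (\<forall>x\<in>K. \<sigma> x = x)}"
  by (simp add: galois_group_def)

lemma galois_group_one: "\<one>\<^bsub>galois_group L K\<^esub> = (\<lambda>x\<in>carrier L. x)"
  by (simp add: galois_group_def BijGroup_def)

lemma galois_group_mult:
  assumes "\<sigma> \<in> carrier (galois_group L K)" "\<tau> \<in> carrier (galois_group L K)"
  shows "\<sigma> \<otimes>\<^bsub>galois_group L K\<^esub> \<tau> = compose (carrier L) \<sigma> \<tau>"
  using assms by (simp add: galois_group_def BijGroup_def)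

lemma galois_group_is_group:
  assumes "ring L" "K \<subseteq> carrier L"
  shows "group (galois_group L K)"
proof -
  interpret ring L by fact
  let ?G = "{\<sigma> \<in> Bij (carrier L). \<sigma> \<in> ring_hom L L \<and> (\<forall>x\<in>K. \<sigma> x = x)}"
  have "subgroup ?G (BijGroup (carrier L))"
  proof (rule subgroup.intro)
    show "?G \<subseteq> carrier (BijGroup (carrier L))"
      by (auto simp: BijGroup_def)
    show "\<one>\<^bsub>BijGroup (carrier L)\<^esub> \<in> ?G"
      using assms(2) by (auto simp: BijGroup_def id_Bij ring_hom_def)
  next
    fix \<sigma> \<tau> assume *: "\<sigma> \<in> ?G" "\<tau> \<in> ?G"
    then have "compose (carrier L) \<sigma> \<tau> \<in> Bij (carrier L)"
      by (simp add: compose_Bij)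
    moreover have "compose (carrier L) \<sigma> \<tau> \<in> ring_hom L L"
      using * by (auto simp: ring_hom_def compose_def Pi_iff)
    ultimately show "\<sigma> \<otimes>\<^bsub>BijGroup (carrier L)\<^esub> \<tau> \<in> ?G"
      using * assms(2) by (auto simp: BijGroup_def compose_def)
  next
    fix \<sigma> assume *: "\<sigma> \<in> ?G"
    \<comment> \<open>This is the inverse in \<open>BijGroup\<close>; the restriction makes it
      extensional, as membership in \<open>Bij\<close> demands.\<close>
    define \<tau> where "\<tau> = restrict (inv_into (carrier L) \<sigma>) (carrier L)"
    have bij: "bij_betw \<sigma> (carrier L) (carrier L)"
      using * by (simp add: Bij_def)
    have hom: "\<sigma> \<in> ring_hom L L"
      using * by simp
    have \<tau>_closed: "\<tau> x \<in> carrier L" and \<sigma>\<tau>: "\<sigma> (\<tau> x) = x" if "x \<in> carrier L" for x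
      using bij that bij_betw_inv_into_right[OF bij] bij_betw_imp_surj_on[OF bij]
      by (auto simp: \<tau>_def inv_into_into)
    \<comment> \<open>By uniqueness of preimages, each homomorphism law for \<open>\<tau>\<close>
      reduces to the same law for \<open>\<sigma>\<close>.\<close>
    have \<tau>I: "\<tau> x = y" if "y \<in> carrier L" "\<sigma> y = x" for x y
      using that bij_betw_inv_into_left[OF bij] ring_hom_closed[OF hom] by (auto simp: \<tau>_def)
    have "\<tau> \<in> ring_hom L L"
      by (rule ring_hom_memI)
        (auto intro!: \<tau>I simp: \<tau>_closed \<sigma>\<tau> ring_hom_mult[OF hom] ring_hom_add[OF hom]
          ring_hom_one[OF hom])
    moreover have "\<forall>x\<in>K. \<tau> x = x"
      using * assms(2) by (auto intro: \<tau>I)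
    moreover have "\<tau> \<in> Bij (carrier L)"
      using * by (simp add: \<tau>_def restrict_inv_into_Bij)
    ultimately show "inv\<^bsub>BijGroup (carrier L)\<^esub> \<sigma> \<in> ?G"
      using * by (simp add: inv_BijGroup \<tau>_def)
  qed
  then show ?thesis
    unfolding galois_group_def by (rule subgroup.subgroup_is_group[OF _ group_BijGroup])
qed

text \<open>
  An automorphism over \<open>K\<close> is determined by its values on a basis, and maps each basis element to
  a root of one fixed polynomial over \<open>K\<close>.
\<close>

lemma finite_galois_group:
  fixes L (structure)
  assumes "field L" and K: "subfield K L" and fin: "ring.finite_dimension L K (carrier L)"
  shows "finite (carrier (galois_group L K))"
proof -
  interpret field L by fact
  have subring: "subring K L"
    using subfieldE(1)[OF K] .
  have K_sub: "K \<subseteq> carrier L"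
    using subringE(1)[OF subring] .
  have "\<exists>F. finite F \<and> (\<forall>\<sigma>\<in>carrier (galois_group L K). \<sigma> x \<in> F)" if x: "x \<in> carrier L" for x
  proof -
    have "(algebraic over K) x"
      using finite_dimension_imp_algebraic[OF K carrier_is_subring fin x] .
    then obtain p where p: "p \<in> carrier (K[X])" "p \<noteq> []" "eval p x = \<zero>"
      using algebraicE[OF subring x] by blast
    have set_p: "set p \<subseteq> K"
      using p(1,2) by (auto simp: univ_poly_def polynomial_def)
    have "is_root p (\<sigma> x)" if \<sigma>: "\<sigma> \<in> carrier (galois_group L K)" for \<sigma>
    proof -
      have hom: "\<sigma> \<in> ring_hom L L" and fixK: "\<And>y. y \<in> K \<Longrightarrow> \<sigma> y = y"
        using \<sigma> by (auto simp: galois_group_carrier)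
      interpret \<sigma>: ring_hom_ring L L \<sigma>
        by (rule ring_hom_ringI2[OF ring_axioms ring_axioms hom])
      \<comment> \<open>The coefficients lie in \<open>K\<close>, so applying
        \<open>\<sigma>\<close> to \<open>eval p x = \<zero>\<close> only moves the
        argument.\<close>
      have "map \<sigma> p = p"
        using set_p fixK by (simp add: map_idI subset_iff)
      then have "eval p (\<sigma> x) = \<zero>"
        using \<sigma>.eval_hom'[OF x, of p] set_p K_sub p(3) by auto
      then show ?thesis
        using p(2) \<sigma>.hom_closed[OF x] by (simp add: is_root_def)
    qed
    then show ?thesis
      using finite_number_of_roots[OF carrier_polynomial_shell[OF subring p(1)]] by blast
  qed
  then obtain F where F: "\<And>x. x \<in> carrier L \<Longrightarrow> finite (F x)"
      "\<And>x \<sigma>. x \<in> carrier L \<Longrightarrow> \<sigma> \<in> carrier (galois_group L K) \<Longrightarrow> \<sigma> x \<in> F x"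
    by metis
  obtain n where "dimension n K (carrier L)"
    using fin by (rule finite_dimensionE')
  then obtain Us where Us: "set Us \<subseteq> carrier L" "Span K Us = carrier L"
    using exists_base[OF K] by blast
  \<comment> \<open>Restriction to the spanning list embeds the group into a finite product of root
    sets.\<close>
  have "inj_on (\<lambda>\<sigma>. restrict \<sigma> (set Us)) (carrier (galois_group L K))"
  proof (rule inj_onI)
    fix \<sigma> \<tau>
    assume \<sigma>: "\<sigma> \<in> carrier (galois_group L K)" and \<tau>: "\<tau> \<in> carrier (galois_group L K)"
      and "restrict \<sigma> (set Us) = restrict \<tau> (set Us)"
    then have eq: "\<sigma> x = \<tau> x" if "x \<in> set Us" for x
      using that by (metis restrict_apply')
    have hom: "\<sigma> \<in> ring_hom L L" "\<tau> \<in> ring_hom L L"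
      and fixK: "\<And>x. x \<in> K \<Longrightarrow> \<sigma> x = x" "\<And>x. x \<in> K \<Longrightarrow> \<tau> x = x"
      using \<sigma> \<tau> by (auto simp: galois_group_carrier)
    interpret \<sigma>: ring_hom_ring L L \<sigma>
      by (rule ring_hom_ringI2[OF ring_axioms ring_axioms hom(1)])
    interpret \<tau>: ring_hom_ring L L \<tau>
      by (rule ring_hom_ringI2[OF ring_axioms ring_axioms hom(2)])
    \<comment> \<open>The vectors range over all lists with entries in \<open>Us\<close>, because
      the recursion of \<open>combine\<close> shortens its lists.\<close>
    have "\<sigma> (combine Ks Vs) = \<tau> (combine Ks Vs)"
      if "set Ks \<subseteq> K" "set Vs \<subseteq> set Us" for Ks Vs
      using that
    proof (induction Ks Vs rule: combine.induct)
      case (1 k Ks v Vs)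
      moreover have "k \<in> carrier L" "v \<in> carrier L" "set Ks \<subseteq> carrier L" "set Vs \<subseteq> carrier L"
        using 1 Us(1) K_sub by auto
      ultimately show ?case
        using fixK eq combine_in_carrier by simp
    qed auto
    then have "\<sigma> x = \<tau> x" if "x \<in> carrier L" for x
      using that unfolding Us(2)[symmetric] Span_eq_combine_set[OF K Us(1)] by blast
    moreover have "\<sigma> \<in> extensional (carrier L)" "\<tau> \<in> extensional (carrier L)"
      using \<sigma> \<tau> by (auto simp: galois_group_carrier Bij_def)
    ultimately show "\<sigma> = \<tau>"
      by (metis extensionalityI)
  qed
  moreover have "(\<lambda>\<sigma>. restrict \<sigma> (set Us)) ` carrier (galois_group L K) \<subseteq> PiE (set Us) F"
    using F(2) Us(1) by auto
  moreover have "finite (PiE (set Us) F)"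
    using F(1) Us(1) by (intro finite_PiE) auto
  ultimately show ?thesis
    by (meson finite_imageD finite_subset)
qed

text \<open>A monic polynomial over \<open>R\<close> has coefficients fixed by
  \<open>\<sigma>\<close>, so it also witnesses the integrality of the image.\<close>

lemma integral_closure_stable:
  fixes L (structure)
  assumes "ring L" "R \<subseteq> carrier L" "\<sigma> \<in> ring_hom L L" "\<And>x. x \<in> R \<Longrightarrow> \<sigma> x = x"
    and x: "x \<in> integral_closure L R"
  shows "\<sigma> x \<in> integral_closure L R"
proof -
  interpret ring L by fact
  interpret \<sigma>: ring_hom_ring L L \<sigma>
    by (rule ring_hom_ringI2[OF ring_axioms ring_axioms assms(3)])
  obtain p where xL: "x \<in> carrier L" and p: "polynomial R p" "p \<noteq> []" "lead_coeff p = \<one>"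
      "eval p x = \<zero>"
    using x by (auto simp: integral_closure_def)
  have set_p: "set p \<subseteq> R"
    using p(1,2) by (auto simp: polynomial_def)
  then have "map \<sigma> p = p"
    using assms(4) by (simp add: map_idI subset_iff)
  then have "eval p (\<sigma> x) = \<zero>"
    using \<sigma>.eval_hom'[OF xL, of p] set_p assms(2) p(4) by auto
  then show ?thesis
    using p xL by (auto simp: integral_closure_def)
qed

section \<open>Subadditive functions on finite groups\<close>

lemma (in group) Sl_pow_le:
  assumes "r \<in> Sl G" "\<sigma> \<in> carrier G"
  shows "r (\<sigma> [^] (n::nat)) \<le> n * r \<sigma>"
proof (induction n)
  case (Suc n)
  have "r (\<sigma> [^] n \<otimes> \<sigma>) \<le> r (\<sigma> [^] n) + r \<sigma>"
    using assms by (auto simp: Sl_def)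
  then show ?case
    using Suc by simp
qed (use assms in \<open>simp add: Sl_def\<close>)

lemma (in group) Sl_inv_eq_0:
  assumes "finite (carrier G)" "r \<in> Sl G" "\<sigma> \<in> carrier G" "r \<sigma> = 0"
  shows "r (inv \<sigma>) = 0"
proof -
  \<comment> \<open>Finiteness makes the order positive, so the subtraction does not
    truncate.\<close>
  have "\<sigma> [^] (order G - 1) \<otimes> \<sigma> = \<sigma> [^] order G"
    using order_gt_0_iff_finite assms(1) by (metis Suc_pred' nat_pow_Suc One_nat_def)
  then have "inv \<sigma> = \<sigma> [^] (order G - 1)"
    using pow_order_eq_1[OF assms(3)] assms(3) by (simp add: inv_equality)
  then show ?thesis
    using Sl_pow_le[OF assms(2,3), of "order G - 1"] assms(4) by simp
qed

section \<open>The action of the Galois group on the uniformizer\<close>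

text \<open>As \<open>max_ideal\<close> is a definite description, existence and uniqueness must
  both be shown. In a principal domain a generator of the nonzero prime \<open>P\<close> is
  irreducible, which makes \<open>P\<close> maximal; conversely maximal ideals are prime.\<close>

lemma (in cring) discrete_valuation_ring_max_ideal:
  assumes "discrete_valuation_ring R"
  shows "max_ideal R \<noteq> {\<zero>}" "maximalideal (max_ideal R) R"
proof -
  interpret principal_domain R
    using assms by (simp add: discrete_valuation_ring_def)
  obtain P where P: "primeideal P R" "P \<noteq> {\<zero>}"
      and uniq: "\<And>Q. primeideal Q R \<Longrightarrow> Q \<noteq> {\<zero>} \<Longrightarrow> Q = P"
    using assms unfolding discrete_valuation_ring_def by blast
  interpret P: primeideal P R by fact
  obtain p where p: "p \<in> carrier R" "P = PIdl p"
    using exists_gen[OF P.is_ideal] by blast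
  have "p \<noteq> \<zero>"
  proof
    assume "p = \<zero>"
    then have "P = {\<zero>}"
      using p cgenideal_eq_genideal[OF zero_closed] genideal_zero by simp
    with P(2) show False ..
  qed
  then have "ring_prime p"
    using p P(1) primeideal_iff_prime[of p] by simp
  then have "ring_irreducible p"
    using p(1) primeness_condition by simp
  then have max: "maximalideal P R"
    using irreducible_imp_maximalideal p by simp
  have "M = P" if "maximalideal M R" for M
  proof (cases "M = {\<zero>}")
    case True
    interpret M: maximalideal M R by fact
    \<comment> \<open>Were the zero ideal maximal, the proper ideal \<open>P\<close> containing it
      would have to equal it, which is the claim.\<close>
    have "P = M \<or> P = carrier R"
      using M.I_maximal[OF P.is_ideal] P.a_subset P.zero_closed True by auto
    then show ?thesis
      using P.I_notcarr by auto
  qed (use uniq maximalideal_prime that in blast)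
  then have "max_ideal R = P"
    unfolding max_ideal_def using max by (intro the_equality)
  then show "max_ideal R \<noteq> {\<zero>}" "maximalideal (max_ideal R) R"
    using P(2) max by auto
qed

section \<open>The fixed extension: its Galois group acting on \<open>S\<close> and on the maximal
  ideal\<close>

context complete_unramified_galois_extension
begin

lemma field_L: "field L" and subfield_K: "subfield K L"
  and finite_dim: "ring.finite_dimension L K (carrier L)"
  using galois by (auto simp: finite_galois_extension_def)

lemma group_G: "group G" and finite_G: "finite (carrier G)"
proof -
  interpret field L by (rule field_L)
  show "group G"
    unfolding G_eq using subringE(1)[OF subfieldE(1)[OF subfield_K]] ring_axioms
    by (rule galois_group_is_group[rotated])
  show "finite (carrier G)"
    unfolding G_eq by (rule finite_galois_group[OF field_L subfield_K finite_dim])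
qed

lemma R_subset_K: "R \<subseteq> K"
proof
  interpret field L by (rule field_L)
  fix x assume "x \<in> R"
  then have "x = x \<otimes>\<^bsub>L\<^esub> inv\<^bsub>L\<^esub> \<one>\<^bsub>L\<^esub>"
    using subringE(1)[OF subring_R] by auto
  moreover have "\<one>\<^bsub>L\<^esub> \<in> R - {\<zero>\<^bsub>L\<^esub>}"
    using subringE(3)[OF subring_R] by simp
  ultimately show "x \<in> K"
    using \<open>x \<in> R\<close> unfolding quotient_field quotient_field_in_def by blast
qed

lemma S_subset: "S \<subseteq> carrier L"
  by (auto simp: S_eq integral_closure_def)

lemma maximalideal_pi: "maximalideal (PIdl\<^bsub>L\<lparr>carrier := S\<rparr>\<^esub> \<pi>) (L\<lparr>carrier := S\<rparr>)"
  and maximalideal_S_eq: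
    "maximalideal M (L\<lparr>carrier := S\<rparr>) \<Longrightarrow> M = PIdl\<^bsub>L\<lparr>carrier := S\<rparr>\<^esub> \<pi>"
  using unique_maximal_ideal by auto

text \<open>
  That the integral closure is a ring needs no proof here, since \<^const>\<open>maximalideal\<close> includes the
  ring axioms.
\<close>

lemma ring_S: "ring (L\<lparr>carrier := S\<rparr>)"
  using maximalideal_pi by (simp add: maximalideal_def ideal_def)

lemma S_mult: "x \<in> S \<Longrightarrow> y \<in> S \<Longrightarrow> x \<otimes>\<^bsub>L\<^esub> y \<in> S"
  using monoid.m_closed[OF ring.is_monoid[OF ring_S]] by simp

lemma S_one: "\<one>\<^bsub>L\<^esub> \<in> S"
  using monoid.one_closed[OF ring.is_monoid[OF ring_S]] by simp

lemma S_pow: "x \<in> S \<Longrightarrow> x [^]\<^bsub>L\<^esub> (n::nat) \<in> S"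
  using monoid.nat_pow_closed[OF ring.is_monoid[OF ring_S], of x n]
  by (simp add: nat_pow_def)

lemma PIdl_S: "PIdl\<^bsub>L\<lparr>carrier := S\<rparr>\<^esub> x = {s \<otimes>\<^bsub>L\<^esub> x | s. s \<in> S}"
  by (simp add: cgenideal_def)

text \<open>
  If \<open>\<pi> = 0\<close>, then by unramifiedness the maximal ideal of \<open>R\<close> would generate the zero ideal.
\<close>

lemma pi_nonzero: "\<pi> \<noteq> \<zero>\<^bsub>L\<^esub>"
proof
  interpret field L by (rule field_L)
  assume "\<pi> = \<zero>\<^bsub>L\<^esub>"
  then have "PIdl\<^bsub>L\<lparr>carrier := S\<rparr>\<^esub> \<pi> \<subseteq> {\<zero>\<^bsub>L\<^esub>}"
    using S_subset by (auto simp: PIdl_S)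
  \<comment> \<open>The description \<open>max_ideal\<close> has a unique solution here because
    \<open>S\<close> has only one maximal ideal.\<close>
  moreover have "max_ideal (L\<lparr>carrier := S\<rparr>) = PIdl\<^bsub>L\<lparr>carrier := S\<rparr>\<^esub> \<pi>"
    unfolding max_ideal_def using maximalideal_pi maximalideal_S_eq by (intro the_equality)
  moreover have "max_ideal (L\<lparr>carrier := R\<rparr>)
      \<subseteq> Idl\<^bsub>L\<lparr>carrier := S\<rparr>\<^esub> (max_ideal (L\<lparr>carrier := R\<rparr>))"
    by (auto simp: genideal_def)
  ultimately have "max_ideal (L\<lparr>carrier := R\<rparr>) \<subseteq> {\<zero>\<^bsub>L\<^esub>}"
    using unramified by (simp add: unramified_in_def)
  moreover interpret R: cring "L\<lparr>carrier := R\<rparr>"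
    using subring_is_domain[OF subring_R] by (rule domain.axioms)
  interpret m: maximalideal "max_ideal (L\<lparr>carrier := R\<rparr>)" "L\<lparr>carrier := R\<rparr>"
    by (rule R.discrete_valuation_ring_max_ideal(2)[OF dvr_R])
  have "\<zero>\<^bsub>L\<^esub> \<in> max_ideal (L\<lparr>carrier := R\<rparr>)"
    using m.zero_closed by simp
  ultimately show False
    using R.discrete_valuation_ring_max_ideal(1)[OF dvr_R] by auto
qed

lemma pi_in_L: "\<pi> \<in> carrier L"
  using pi_in_S S_subset by auto

lemma G_hom: "\<sigma> \<in> carrier G \<Longrightarrow> \<sigma> \<in> ring_hom L L"
  by (simp add: G_eq galois_group_carrier)

lemma G_closed_S:
  assumes "\<sigma> \<in> carrier G" "x \<in> S"
  shows "\<sigma> x \<in> S"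
  unfolding S_eq
proof (rule integral_closure_stable[OF _ subringE(1)[OF subring_R] G_hom[OF assms(1)]])
  show "ring L"
    using field_L by (simp add: field.is_ring)
  show "\<sigma> y = y" if "y \<in> R" for y
    using assms(1) that R_subset_K by (auto simp: G_eq galois_group_carrier)
qed (use assms(2) in \<open>simp flip: S_eq\<close>)

lemma G_mult_apply:
  assumes "\<sigma> \<in> carrier G" "\<tau> \<in> carrier G" "x \<in> carrier L"
  shows "(\<sigma> \<otimes>\<^bsub>G\<^esub> \<tau>) x = \<sigma> (\<tau> x)"
  using assms by (simp add: G_eq galois_group_mult compose_def)

lemma G_inv_apply:
  assumes "\<sigma> \<in> carrier G" "x \<in> carrier L"
  shows "(inv\<^bsub>G\<^esub> \<sigma>) (\<sigma> x) = x" "\<sigma> ((inv\<^bsub>G\<^esub> \<sigma>) x) = x"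
proof -
  interpret G: group G by (rule group_G)
  have one: "\<one>\<^bsub>G\<^esub> x = x"
    using assms by (simp add: G_eq galois_group_one)
  show "(inv\<^bsub>G\<^esub> \<sigma>) (\<sigma> x) = x" "\<sigma> ((inv\<^bsub>G\<^esub> \<sigma>) x) = x"
    using one assms G_mult_apply[of "inv\<^bsub>G\<^esub> \<sigma>" \<sigma> x] G_mult_apply[of \<sigma> "inv\<^bsub>G\<^esub> \<sigma>" x]
    by simp_all
qed

lemma G_hom_S:
  assumes "\<sigma> \<in> carrier G"
  shows "ring_hom_ring (L\<lparr>carrier := S\<rparr>) (L\<lparr>carrier := S\<rparr>) \<sigma>"
proof (rule ring_hom_ringI2[OF ring_S ring_S], rule ring_hom_memI)
  fix x y assume "x \<in> carrier (L\<lparr>carrier := S\<rparr>)" "y \<in> carrier (L\<lparr>carrier := S\<rparr>)"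
  then have "x \<in> carrier L" "y \<in> carrier L"
    using S_subset by auto
  then show "\<sigma> (x \<otimes>\<^bsub>L\<lparr>carrier := S\<rparr>\<^esub> y) = \<sigma> x \<otimes>\<^bsub>L\<lparr>carrier := S\<rparr>\<^esub> \<sigma> y"
    and "\<sigma> (x \<oplus>\<^bsub>L\<lparr>carrier := S\<rparr>\<^esub> y) = \<sigma> x \<oplus>\<^bsub>L\<lparr>carrier := S\<rparr>\<^esub> \<sigma> y"
    using ring_hom_mult[OF G_hom[OF assms]] ring_hom_add[OF G_hom[OF assms]] by simp_all
qed (use G_closed_S[OF assms] ring_hom_one[OF G_hom[OF assms]] in simp_all)

lemma u_unit:
  assumes \<sigma>: "\<sigma> \<in> carrier G"
  shows "u_fun L \<pi> \<sigma> \<in> Units (L\<lparr>carrier := S\<rparr>)" "\<sigma> \<pi> = u_fun L \<pi> \<sigma> \<otimes>\<^bsub>L\<^esub> \<pi>"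
proof -
  interpret field L by (rule field_L)
  interpret G: group G by (rule group_G)
  have inv_\<sigma>: "inv\<^bsub>G\<^esub> \<sigma> \<in> carrier G"
    using \<sigma> by simp
  \<comment> \<open>Stated for every \<open>\<tau>\<close>, since it is applied to both
    \<open>\<sigma>\<close> and its inverse to obtain divisibility in both directions.\<close>
  have vimage: "{x \<in> S. \<tau> x \<in> PIdl\<^bsub>L\<lparr>carrier := S\<rparr>\<^esub> \<pi>} = PIdl\<^bsub>L\<lparr>carrier := S\<rparr>\<^esub> \<pi>"
    if \<tau>: "\<tau> \<in> carrier G" for \<tau>
  proof (rule maximalideal_S_eq)
    have "\<tau> ((inv\<^bsub>G\<^esub> \<tau>) x) = x" "(inv\<^bsub>G\<^esub> \<tau>) (\<tau> x) = x" if "x \<in> S" for x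
      using that G_inv_apply[OF \<tau>] S_subset by blast+
    then show "maximalideal {x \<in> S. \<tau> x \<in> PIdl\<^bsub>L\<lparr>carrier := S\<rparr>\<^esub> \<pi>} (L\<lparr>carrier := S\<rparr>)"
      using ring.maximalideal_vimage_iso[OF ring_S G_hom_S[OF \<tau>]
        G_hom_S[OF G.inv_closed[OF \<tau>]] _ _ maximalideal_pi] by simp
  qed
  have "\<pi> = \<one>\<^bsub>L\<^esub> \<otimes>\<^bsub>L\<^esub> \<pi>"
    using pi_in_L by simp
  then have "\<pi> \<in> PIdl\<^bsub>L\<lparr>carrier := S\<rparr>\<^esub> \<pi>"
    using S_one unfolding PIdl_S by blast
  then have "\<tau> \<pi> \<in> PIdl\<^bsub>L\<lparr>carrier := S\<rparr>\<^esub> \<pi>" if "\<tau> \<in> carrier G" for \<tau>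
    using vimage[OF that] by blast
  from this[OF \<sigma>] this[OF inv_\<sigma>] obtain s t
    where s: "s \<in> S" "\<sigma> \<pi> = s \<otimes>\<^bsub>L\<^esub> \<pi>" and t: "t \<in> S" "(inv\<^bsub>G\<^esub> \<sigma>) \<pi> = t \<otimes>\<^bsub>L\<^esub> \<pi>"
    unfolding PIdl_S by blast
  have carr: "s \<in> carrier L" "t \<in> carrier L" "\<sigma> t \<in> S" "\<sigma> t \<in> carrier L"
    using s t S_subset G_closed_S[OF \<sigma>] by auto
  have pi_unit: "\<pi> \<in> Units L"
    using pi_nonzero pi_in_L field_Units by auto
  then have u: "u_fun L \<pi> \<sigma> = s"
    using s(2) carr pi_in_L by (simp add: u_fun_def m_assoc)
  \<comment> \<open>Applying \<open>\<sigma>\<close> to the relation for its inverse and cancelling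
    \<open>\<pi>\<close> exhibits \<open>\<sigma> t\<close> as an inverse of \<open>s\<close> within
    \<open>S\<close>.\<close>
  have "\<pi> = \<sigma> (t \<otimes>\<^bsub>L\<^esub> \<pi>)"
    using G_inv_apply(2)[OF \<sigma> pi_in_L] t by simp
  also have "\<dots> = (\<sigma> t \<otimes>\<^bsub>L\<^esub> s) \<otimes>\<^bsub>L\<^esub> \<pi>"
    using ring_hom_mult[OF G_hom[OF \<sigma>] carr(2) pi_in_L] s(2) carr pi_in_L by (simp add: m_assoc)
  finally have "\<sigma> t \<otimes>\<^bsub>L\<^esub> s = \<one>\<^bsub>L\<^esub>"
    using pi_nonzero pi_in_L carr by (metis m_rcancel l_one m_closed one_closed)
  moreover from this have "s \<otimes>\<^bsub>L\<^esub> \<sigma> t = \<one>\<^bsub>L\<^esub>"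
    using m_comm carr by simp
  ultimately show "u_fun L \<pi> \<sigma> \<in> Units (L\<lparr>carrier := S\<rparr>)" "\<sigma> \<pi> = u_fun L \<pi> \<sigma> \<otimes>\<^bsub>L\<^esub> \<pi>"
    using u s carr(3) by (auto simp: Units_def)
qed

text \<open>A unit multiple of \<open>\<pi>\<close> would force the principal ideal of
  \<open>\<pi>\<close> to be all of \<open>S\<close>, but a maximal ideal is proper.\<close>

lemma pi_not_unit:
  assumes "s \<in> S"
  shows "s \<otimes>\<^bsub>L\<^esub> \<pi> \<notin> Units (L\<lparr>carrier := S\<rparr>)"
proof
  interpret field L by (rule field_L)
  assume "s \<otimes>\<^bsub>L\<^esub> \<pi> \<in> Units (L\<lparr>carrier := S\<rparr>)"
  then obtain t where t: "t \<in> S" "t \<otimes>\<^bsub>L\<^esub> (s \<otimes>\<^bsub>L\<^esub> \<pi>) = \<one>\<^bsub>L\<^esub>"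
    by (auto simp: Units_def)
  have "x \<in> PIdl\<^bsub>L\<lparr>carrier := S\<rparr>\<^esub> \<pi>" if "x \<in> S" for x
  proof -
    have "x = (x \<otimes>\<^bsub>L\<^esub> (t \<otimes>\<^bsub>L\<^esub> s)) \<otimes>\<^bsub>L\<^esub> \<pi>"
      using t that assms S_subset pi_in_L by (simp add: m_assoc subset_iff)
    then show ?thesis
      using that t(1) assms S_mult unfolding PIdl_S by blast
  qed
  moreover have "PIdl\<^bsub>L\<lparr>carrier := S\<rparr>\<^esub> \<pi> \<subseteq> S"
    using pi_in_S S_mult by (auto simp: PIdl_S)
  ultimately have "S = PIdl\<^bsub>L\<lparr>carrier := S\<rparr>\<^esub> \<pi>"
    by blast
  then show False
    using maximalideal.I_notcarr[OF maximalideal_pi] by simp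
qed

section \<open>The function \<open>b_fun\<close>: coboundary formula, integrality and inertial
  group\<close>

lemma b_fun_coboundary:
  assumes r: "r \<in> Sl G" and \<sigma>: "\<sigma> \<in> carrier G" and \<tau>: "\<tau> \<in> carrier G"
  shows "b_fun L G \<pi> r \<sigma> \<tau> =
    \<pi> [^]\<^bsub>L\<^esub> r \<sigma> \<otimes>\<^bsub>L\<^esub> \<sigma> (\<pi> [^]\<^bsub>L\<^esub> r \<tau>) \<otimes>\<^bsub>L\<^esub> inv\<^bsub>L\<^esub> (\<pi> [^]\<^bsub>L\<^esub> r (\<sigma> \<otimes>\<^bsub>G\<^esub> \<tau>))"
proof -
  interpret field L by (rule field_L)
  interpret \<sigma>: ring_hom_ring L L \<sigma>
    by (rule ring_hom_ringI2[OF ring_axioms ring_axioms G_hom[OF \<sigma>]])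
  define u where "u = u_fun L \<pi> \<sigma>"
  define k where "k = r \<sigma> + r \<tau> - r (\<sigma> \<otimes>\<^bsub>G\<^esub> \<tau>)"
  \<comment> \<open>Subadditivity enters here: it rules out truncation, so the exponent can be split
    again below.\<close>
  have k: "k + r (\<sigma> \<otimes>\<^bsub>G\<^esub> \<tau>) = r \<sigma> + r \<tau>"
    using r \<sigma> \<tau> by (simp add: Sl_def k_def)
  have u: "u \<in> carrier L"
    using u_unit(1)[OF \<sigma>] S_subset by (auto simp: Units_def u_def)
  have unit: "\<pi> [^]\<^bsub>L\<^esub> r (\<sigma> \<otimes>\<^bsub>G\<^esub> \<tau>) \<in> Units L"
    using pi_nonzero pi_in_L field_Units by (intro Units_pow_closed) auto
  have "\<pi> [^]\<^bsub>L\<^esub> r \<sigma> \<otimes>\<^bsub>L\<^esub> \<sigma> (\<pi> [^]\<^bsub>L\<^esub> r \<tau>)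
      = \<pi> [^]\<^bsub>L\<^esub> r \<sigma> \<otimes>\<^bsub>L\<^esub> (u [^]\<^bsub>L\<^esub> r \<tau> \<otimes>\<^bsub>L\<^esub> \<pi> [^]\<^bsub>L\<^esub> r \<tau>)"
    using pi_in_L u u_unit(2)[OF \<sigma>] by (simp add: \<sigma>.hom_nat_pow nat_pow_distrib u_def)
  also have "\<dots> = u [^]\<^bsub>L\<^esub> r \<tau> \<otimes>\<^bsub>L\<^esub> \<pi> [^]\<^bsub>L\<^esub> (r \<sigma> + r \<tau>)"
    using pi_in_L u by (simp add: nat_pow_mult[symmetric] m_lcomm)
  also have "\<dots> = (u [^]\<^bsub>L\<^esub> r \<tau> \<otimes>\<^bsub>L\<^esub> \<pi> [^]\<^bsub>L\<^esub> k) \<otimes>\<^bsub>L\<^esub> \<pi> [^]\<^bsub>L\<^esub> r (\<sigma> \<otimes>\<^bsub>G\<^esub> \<tau>)"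
    unfolding k[symmetric] using pi_in_L u by (simp add: nat_pow_mult[symmetric] m_assoc)
  finally show ?thesis
    using unit pi_in_L u by (simp add: b_fun_def m_assoc flip: u_def k_def)
qed

text \<open>Both \<open>u\<close> and \<open>\<pi>\<close> are nonzero elements of \<open>S\<close>
  and the exponents are natural numbers; products of such powers stay in \<open>S\<close> and do not
  vanish in the field.\<close>

lemma b_fun_nonzero_integral:
  assumes "\<sigma> \<in> carrier G"
  shows "b_fun L G \<pi> r \<sigma> \<tau> \<in> nonzero_elems L S"
proof -
  interpret field L by (rule field_L)
  define u where "u = u_fun L \<pi> \<sigma>"
  have u: "u \<in> S" "u \<in> carrier L" "u \<noteq> \<zero>\<^bsub>L\<^esub>"
    using u_unit(1)[OF assms] S_subset by (auto simp: Units_def u_def subset_iff)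
  have nz: "x [^]\<^bsub>L\<^esub> (n::nat) \<noteq> \<zero>\<^bsub>L\<^esub>" if "x \<in> carrier L" "x \<noteq> \<zero>\<^bsub>L\<^esub>" for x n
    using that Units_pow_closed[of x n] field_Units by auto
  show ?thesis
    using u nz pi_nonzero pi_in_L pi_in_S
    by (simp add: nonzero_elems_def b_fun_def u_def[symmetric] S_mult S_pow integral_iff)
qed

lemma b_fun_in_B2:
  assumes "r \<in> Sl G"
  shows "b_fun L G \<pi> r \<in> B2 L S G"
proof -
  interpret field L by (rule field_L)
  \<comment> \<open>Needed for the values of the witness cochain; its normalisation at the identity
    comes from \<open>r\<close> vanishing there.\<close>
  have "\<pi> [^]\<^bsub>L\<^esub> (n::nat) \<noteq> \<zero>\<^bsub>L\<^esub>" for n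
    using Units_pow_closed[of \<pi> n] field_Units pi_nonzero pi_in_L by auto
  then show ?thesis
    unfolding B2_def using assms b_fun_nonzero_integral b_fun_coboundary[OF assms]
    by (auto simp: nonzero_elems_def S_pow pi_in_S Sl_def intro!: bexI[of _ "\<lambda>\<sigma>. \<pi> [^]\<^bsub>L\<^esub> r \<sigma>"])
qed

lemma b_fun_unit_iff:
  assumes r: "r \<in> Sl G" and \<sigma>: "\<sigma> \<in> carrier G"
  shows "b_fun L G \<pi> r \<sigma> (inv\<^bsub>G\<^esub> \<sigma>) \<in> Units (L\<lparr>carrier := S\<rparr>) \<longleftrightarrow> r \<sigma> = 0"
proof -
  interpret field L by (rule field_L)
  interpret S: ring "L\<lparr>carrier := S\<rparr>" by (rule ring_S)
  interpret G: group G by (rule group_G)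
  define u where "u = u_fun L \<pi> \<sigma>"
  have u: "u \<in> Units (L\<lparr>carrier := S\<rparr>)" "u \<in> S" "u \<in> carrier L"
    using u_unit(1)[OF \<sigma>] S_subset by (auto simp: u_def Units_def)
  \<comment> \<open>The subtracted term is the value of \<open>r\<close> at the identity, hence
    zero.\<close>
  have b: "b_fun L G \<pi> r \<sigma> (inv\<^bsub>G\<^esub> \<sigma>)
      = u [^]\<^bsub>L\<^esub> r (inv\<^bsub>G\<^esub> \<sigma>) \<otimes>\<^bsub>L\<^esub> \<pi> [^]\<^bsub>L\<^esub> (r \<sigma> + r (inv\<^bsub>G\<^esub> \<sigma>))"
    using r \<sigma> by (simp add: b_fun_def u_def Sl_def)
  show ?thesis
  proof
    assume "r \<sigma> = 0"
    then have "r (inv\<^bsub>G\<^esub> \<sigma>) = 0"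
      using G.Sl_inv_eq_0[OF finite_G r \<sigma>] by simp
    then show "b_fun L G \<pi> r \<sigma> (inv\<^bsub>G\<^esub> \<sigma>) \<in> Units (L\<lparr>carrier := S\<rparr>)"
      using \<open>r \<sigma> = 0\<close> S.Units_one_closed by (simp add: b)
  next
    assume unit: "b_fun L G \<pi> r \<sigma> (inv\<^bsub>G\<^esub> \<sigma>) \<in> Units (L\<lparr>carrier := S\<rparr>)"
    show "r \<sigma> = 0"
    proof (rule ccontr)
      assume "r \<sigma> \<noteq> 0"
      \<comment> \<open>A positive exponent splits off one factor \<open>\<pi>\<close>, leaving a
        cofactor in \<open>S\<close>, so \<open>pi_not_unit\<close> applies.\<close>
      then obtain k where "r \<sigma> + r (inv\<^bsub>G\<^esub> \<sigma>) = Suc k"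
        by (metis add_is_0 not0_implies_Suc)
      then have "b_fun L G \<pi> r \<sigma> (inv\<^bsub>G\<^esub> \<sigma>)
          = (u [^]\<^bsub>L\<^esub> r (inv\<^bsub>G\<^esub> \<sigma>) \<otimes>\<^bsub>L\<^esub> \<pi> [^]\<^bsub>L\<^esub> k) \<otimes>\<^bsub>L\<^esub> \<pi>"
        using b u pi_in_L by (simp add: m_assoc)
      then show False
        using unit pi_not_unit S_mult S_pow u(2) pi_in_S by metis
    qed
  qed
qed

end

theorem proposition3p2:
  fixes L :: "('a, 'm) ring_scheme" and K R S :: "'a set"
    and G :: "('a \<Rightarrow> 'a) monoid" and \<pi> :: 'a and r :: "('a \<Rightarrow> 'a) \<Rightarrow> nat"
  assumes "complete_unramified_galois_extension L K R S G \<pi>"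
    and "r \<in> Sl G"
  shows "b_fun L G \<pi> r \<in> B2 L S G \<and> inertial_group L S G (b_fun L G \<pi> r) = M_set G r"
proof -
  interpret complete_unramified_galois_extension L K R S G \<pi> by fact
  show ?thesis
    using b_fun_in_B2[OF assms(2)] b_fun_unit_iff[OF assms(2)]
    by (auto simp: inertial_group_def M_set_def)
qed

end
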